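(* Let $(B,+,\cdot)$ be a finite skew brace such that $(B,+)$ is a solvable $\mathrm{CCS}$ group. Then the multiplicative group $(B,\cdot)$ is solvable.
   Context: A skew brace (skew left brace) is a triple $(B,+,\cdot)$ such that $(B,+)$ and $(B,\cdot)$ are groups (neither assumed abelian) and $a\cdot(b+c)=a\cdot b-a+a\cdot c$ for all $a,b,c\in B$, where $-a$ is the inverse of $a$ in $(B,+)$. A group is characteristically simple if it has no characteristic subgroups other than the trivial subgroup and itself. A $\mathrm{CCS}$ group is a finite group $G$ that is non-cyclic, not characteristically simple, and such that every proper characteristic subgroup of $G$ is cyclic. *)

theory Defs
  imports "HOL-Algebra.Algebra"
begin

text \<open>
  A skew brace is carried by the ring record: \<open>\<otimes>\<close>, \<open>\<one>\<close> give the multiplicative group and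
  \<open>\<oplus>\<close>, \<open>\<zero>\<close> (through \<open>add_monoid\<close>) the additive one. Neither is assumed commutative,
  so the order of the three summands in the compatibility law matters; here
  \<open>u \<ominus> v\<close> is \<open>u \<oplus> (\<ominus> v)\<close>.
\<close>

locale skew_brace =
  fixes B (structure)
  assumes add_group: "group (add_monoid B)"
    and mult_group: "group B"
    and skew_distrib:
      "\<lbrakk>a \<in> carrier B; b \<in> carrier B; c \<in> carrier B\<rbrakk>
        \<Longrightarrow> a \<otimes> (b \<oplus> c) = ((a \<otimes> b) \<ominus> a) \<oplus> (a \<otimes> c)"

definition characteristic_subgroup :: "'a set \<Rightarrow> ('a, 'b) monoid_scheme \<Rightarrow> bool"
  where "characteristic_subgroup H G \<longleftrightarrow>
    subgroup H G \<and> (\<forall>\<phi> \<in> iso G G. \<phi> ` H = H)"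

text \<open>The trivial group counts as characteristically simple.\<close>

definition characteristically_simple :: "('a, 'b) monoid_scheme \<Rightarrow> bool"
  where "characteristically_simple G \<longleftrightarrow>
    (\<forall>H. characteristic_subgroup H G \<longrightarrow> H = {\<one>\<^bsub>G\<^esub>} \<or> H = carrier G)"

definition CCS_group :: "('a, 'b) monoid_scheme \<Rightarrow> bool"
  where "CCS_group G \<longleftrightarrow>
    group G \<and> finite (carrier G) \<and> \<not> cyclic_group G \<and> \<not> characteristically_simple G \<and>
    (\<forall>H. characteristic_subgroup H G \<and> H \<noteq> carrier G \<longrightarrow> cyclic_group (G\<lparr>carrier := H\<rparr>))"

end

theory Submission
  imports Defs
begin

text \<open>
  Write \<open>A\<close> for the additive group. The map \<open>\<lambda>\<close> with \<open>\<lambda> a b = - a + a b\<close> is a homomorphism from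
  the multiplicative group to \<open>Aut A\<close>, and on its kernel the two operations agree, so the kernel is
  isomorphic to a subgroup of \<open>A\<close>. Hence it suffices that \<open>Aut A\<close> is solvable; this holds unless
  \<open>A\<close> is a \<open>p\<close>-group, in which case the multiplicative group is a \<open>p\<close>-group too.

  Let \<open>D\<close> be the derived subgroup of \<open>A\<close>, which is proper and therefore cyclic, and let \<open>C\<close> be its
  centralizer, which contains \<open>D\<close>. If \<open>C\<close> is proper, it is cyclic and contains its own centralizer,
  and then \<open>Aut A\<close> is metabelian. Otherwise \<open>A\<close> has class at most two, so for each prime \<open>p\<close> the
  elements of \<open>p\<close>-power order form a characteristic subgroup. If none of these is \<open>A\<close>, they are all
  cyclic, so any two automorphisms commute on each of them; as they contain the Sylow subgroups, they
  generate \<open>A\<close>, and \<open>Aut A\<close> is abelian.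
\<close>

section \<open>Commutators and centralizers\<close>

text \<open>The center is used in the form \<open>centralizer G (carrier G)\<close>.\<close>

definition centralizer :: "('a, 'b) monoid_scheme \<Rightarrow> 'a set \<Rightarrow> 'a set"
  where "centralizer G S = {x \<in> carrier G. \<forall>s\<in>S. x \<otimes>\<^bsub>G\<^esub> s = s \<otimes>\<^bsub>G\<^esub> x}"

context group
begin

lemma commutator_eq_one_iff:
  assumes "x \<in> carrier G" "y \<in> carrier G"
  shows "x \<otimes> y \<otimes> inv x \<otimes> inv y = \<one> \<longleftrightarrow> x \<otimes> y = y \<otimes> x"
  using assms inv_solve_right'[of \<one> "x \<otimes> y \<otimes> inv x" y] inv_solve_right'[of y "x \<otimes> y" x]
  by auto

lemma derived_subset:
  assumes "subgroup N G"
    and "\<And>x y. \<lbrakk>x \<in> H; y \<in> H\<rbrakk> \<Longrightarrow> x \<otimes> y \<otimes> inv x \<otimes> inv y \<in> N"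
  shows "derived G H \<subseteq> N"
  unfolding derived_def by (rule generate_subgroup_incl[OF _ assms(1)]) (use assms(2) in auto)

text \<open>Iterated derived subgroups are monotone in the starting subgroup, so those of
  \<open>H\<close> die no later than those of \<open>K\<close>.\<close>

lemma solvable_seq_mono:
  assumes "subgroup H G" "solvable_seq G K" "H \<subseteq> K"
  shows "solvable_seq G H"
proof -
  obtain n where "(derived G ^^ n) K = {\<one>}"
    using solvable_imp_trivial_derived_seq[OF assms(2)] by blast
  moreover have "\<one> \<in> (derived G ^^ n) H"
    using subgroup.one_closed[OF exp_of_derived_is_subgroup[OF assms(1)]] .
  ultimately have "(derived G ^^ n) H = {\<one>}"
    using mono_exp_of_derived[OF assms(3), of n] by blast
  then show ?thesis
    by (rule trivial_derived_seq_imp_solvable[OF assms(1)])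
qed

text \<open>The commutators generate \<open>derived G H\<close>, which then lies in the solvable
  \<open>N\<close>; one more step of the series reaches \<open>H\<close>. The arguments below for
  p-groups and for automorphism groups go through this criterion.\<close>

lemma solvable_seq_commutators:
  assumes "subgroup H G" "solvable_seq G N"
    and "\<And>x y. \<lbrakk>x \<in> H; y \<in> H\<rbrakk> \<Longrightarrow> x \<otimes> y \<otimes> inv x \<otimes> inv y \<in> N"
  shows "solvable_seq G H"
proof (rule augment_solvable_seq[OF assms(1)], rule solvable_seq_mono[OF _ assms(2)])
  show "subgroup (derived G H) G"
    using derived_is_subgroup subgroup.subset[OF assms(1)] by blast
  show "derived G H \<subseteq> N"
    using derived_subset[OF solvable_imp_subgroup[OF assms(2)] assms(3)] .
qed

lemma centralizer_subgroup:
  assumes "S \<subseteq> carrier G"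
  shows "subgroup (centralizer G S) G"
proof (rule subgroupI)
  fix a b assume "a \<in> centralizer G S" "b \<in> centralizer G S"
  then have ab: "a \<in> carrier G" "b \<in> carrier G" and
    comm: "\<And>s. s \<in> S \<Longrightarrow> a \<otimes> s = s \<otimes> a" "\<And>s. s \<in> S \<Longrightarrow> b \<otimes> s = s \<otimes> b"
    unfolding centralizer_def by auto
  have "a \<otimes> b \<otimes> s = s \<otimes> (a \<otimes> b)" if "s \<in> S" for s
  proof -
    have s: "s \<in> carrier G" using that assms by blast
    have "a \<otimes> b \<otimes> s = (a \<otimes> s) \<otimes> b"
      using ab s comm(2)[OF that] by (simp add: m_assoc)
    also have "\<dots> = s \<otimes> (a \<otimes> b)"
      using ab s comm(1)[OF that] by (simp add: m_assoc)
    finally show ?thesis .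
  qed
  with ab show "a \<otimes> b \<in> centralizer G S"
    unfolding centralizer_def by simp
next
  fix a assume "a \<in> centralizer G S"
  then have a: "a \<in> carrier G" and comm: "\<And>s. s \<in> S \<Longrightarrow> a \<otimes> s = s \<otimes> a"
    unfolding centralizer_def by auto
  have "inv a \<otimes> s = s \<otimes> inv a" if "s \<in> S" for s
  proof -
    have s: "s \<in> carrier G" using that assms by blast
    have "inv a \<otimes> s = inv a \<otimes> (s \<otimes> a) \<otimes> inv a"
      using a s by (simp add: m_assoc)
    also have "\<dots> = s \<otimes> inv a"
      using a s comm[OF that, symmetric] by (simp add: m_assoc[symmetric])
    finally show ?thesis .
  qed
  with a show "inv a \<in> centralizer G S"
    unfolding centralizer_def by simp
qed (use assms in \<open>auto simp: centralizer_def subset_iff intro!: exI[of _ \<one>]\<close>)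

end

section \<open>Solvability of finite p-groups\<close>

lemma prime_power_dvd:
  fixes p :: nat
  assumes "Factorial_Ring.prime p" "d dvd p ^ n" "d \<noteq> 1"
  shows "p dvd d"
proof -
  obtain i where i: "d = p ^ i"
    using divides_primepow_nat[OF assms(1)] assms(2) by blast
  then have "i \<noteq> 0"
    using assms(3) by (metis power_0)
  with i show ?thesis
    by simp
qed

text \<open>Orbit sizes divide \<open>p ^ n\<close>, so an orbit that is not a single fixed point
  has size divisible by \<open>p\<close>. If \<open>e\<close> were the only fixed point,
  \<open>card E\<close> would be 1 modulo \<open>p\<close>.\<close>

lemma (in group_action) two_fixed_points:
  assumes "Factorial_Ring.prime p" "order G = p ^ n" "finite E" "p dvd card E"
    and e: "e \<in> E" "\<And>g. g \<in> carrier G \<Longrightarrow> \<phi> g e = e"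
  shows "\<exists>x\<in>E. x \<noteq> e \<and> (\<forall>g\<in>carrier G. \<phi> g x = x)"
proof (rule ccontr)
  assume neg: "\<not> ?thesis"
  interpret G: group G
    using group_hom group_hom.axioms(1) by auto
  have orb_e: "orbit G \<phi> e = {e}"
    using e unfolding orbit_def by (auto intro!: exI[of _ \<one>])
  have fin: "finite (orbits G E \<phi>)"
    using orbits_coverture assms(3) by (metis finite_UnionD)
  have orb_dvd: "p dvd card R" if R: "R \<in> orbits G E \<phi> - {{e}}" for R
  proof -
    from R obtain x where x: "x \<in> E" "R = orbit G \<phi> x" "R \<noteq> {e}"
      unfolding orbits_def by auto
    have xR: "x \<in> R"
      using orbit_refl x by blast
    have "card R \<noteq> 1"
    proof
      assume "card R = 1"
      then have "R = {x}"
        using xR by (auto simp: card_1_singleton_iff)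
      then have "\<forall>g\<in>carrier G. \<phi> g x = x"
        using x(2) unfolding orbit_def by blast
      moreover have "x \<noteq> e"
        using x(3) \<open>R = {x}\<close> by simp
      ultimately show False
        using neg x(1) by metis
    qed
    moreover have "card R dvd p ^ n"
      using orbit_stabilizer_theorem[OF x(1)] assms(2) x(2) by (metis dvd_triv_left)
    ultimately show ?thesis
      using prime_power_dvd[OF assms(1)] by blast
  qed
  have "card E = (\<Sum>R\<in>orbits G E \<phi>. card R)"
    using disjoint_sum[OF assms(3), of "\<lambda>_. 1::nat"] by simp
  also have "\<dots> = card {e} + (\<Sum>R\<in>orbits G E \<phi> - {{e}}. card R)"
    using fin e(1) orb_e by (subst sum.remove[of _ "{e}"]) (auto simp: orbits_def)
  finally have "card E = 1 + (\<Sum>R\<in>orbits G E \<phi> - {{e}}. card R)"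
    by simp
  moreover have "p dvd (\<Sum>R\<in>orbits G E \<phi> - {{e}}. card R)"
    using orb_dvd by (rule dvd_sum)
  ultimately have "p dvd 1"
    using assms(4) by (metis dvd_add_left_iff)
  then show False
    using assms(1) not_prime_unit by blast
qed

text \<open>Under conjugation the fixed points are the central elements, and \<open>\<one>\<close>
  is one of them, so a second one exists.\<close>

lemma (in group) p_group_center_nontrivial:
  assumes "Factorial_Ring.prime p" "order G = p ^ n" "carrier G \<noteq> {\<one>}"
  shows "\<exists>z\<in>centralizer G (carrier G). z \<noteq> \<one>"
proof -
  interpret conj: group_action G "carrier G" "\<lambda>g. \<lambda>h\<in>carrier G. g \<otimes> h \<otimes> inv g"
    by (rule action_by_conjugation)
  have pos: "order G > 0"
    using assms(1,2) prime_gt_0_nat by simp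
  then have fin: "finite (carrier G)"
    by (simp add: order_gt_0_iff_finite)
  have "card (carrier G) \<noteq> 1"
    using assms(3) one_closed by (metis card_1_singletonE singletonD)
  then have "p dvd card (carrier G)"
    using prime_power_dvd[OF assms(1), of _ n] assms(2) by (simp add: order_def)
  then obtain z where z: "z \<in> carrier G" "z \<noteq> \<one>" "\<forall>g\<in>carrier G. g \<otimes> z \<otimes> inv g = z"
    using conj.two_fixed_points[OF assms(1,2) fin, of \<one>] by auto
  then have "z \<in> centralizer G (carrier G)"
    unfolding centralizer_def by (auto simp: inv_solve_right')
  with z(2) show ?thesis by blast
qed

text \<open>\<open>h\<close> sends the commutator to a commutator with a central element. For a
  quotient map this puts the commutators of the preimage of the center into the kernel.\<close>

lemma (in group_hom) center_preimage_commutator: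
  assumes "x \<in> carrier G" "h x \<in> centralizer H (carrier H)" "y \<in> carrier G"
  shows "x \<otimes> y \<otimes> inv x \<otimes> inv y \<in> kernel G H h"
proof -
  have "h x \<otimes>\<^bsub>H\<^esub> h y = h y \<otimes>\<^bsub>H\<^esub> h x"
    using assms by (simp add: centralizer_def)
  then show ?thesis
    using assms(1,3) H.commutator_eq_one_iff[of "h x" "h y"] by (simp add: kernel_def)
qed

text \<open>Conjugation does not change the image of an element whose image is central.\<close>

lemma (in group_hom) center_preimage_normal:
  "{x \<in> carrier G. h x \<in> centralizer H (carrier H)} \<lhd> G" (is "?M \<lhd> G")
proof (subst G.normal_inv_iff, intro conjI ballI)
  note C = H.centralizer_subgroup[OF subset_refl]
  show "subgroup ?M G"
    using subgroup.one_closed[OF C] subgroup.m_closed[OF C] subgroup.m_inv_closed[OF C]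
    by (intro G.subgroupI) auto
  fix x y assume x: "x \<in> carrier G" and y: "y \<in> ?M"
  then have "h x \<otimes>\<^bsub>H\<^esub> h y = h y \<otimes>\<^bsub>H\<^esub> h x"
    by (simp add: centralizer_def)
  then have "h (x \<otimes> y \<otimes> inv x) = h y"
    using x y by (simp add: H.m_assoc)
  then show "x \<otimes> y \<otimes> inv x \<in> ?M"
    using x y by simp
qed

text \<open>A normal solvable subgroup \<open>N\<close> of largest order is everything: otherwise
  the quotient is a nontrivial p-group with nontrivial center, and the preimage of that center is
  normal, solvable and larger.\<close>

theorem (in group) p_group_solvable:
  assumes "Factorial_Ring.prime p" "order G = p ^ n"
  shows "solvable G"
proof -
  have fin: "finite (carrier G)"
    using assms prime_gt_0_nat order_gt_0_iff_finite by simp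
  let ?P = "\<lambda>N. N \<lhd> G \<and> solvable_seq G N"
  have "?P {\<one>}"
    using one_is_normal solvable_seq.unity by blast
  \<comment> \<open>\<open>Suc\<close> turns the bound by the group order into the strict one that
    the maximum principle takes.\<close>
  moreover have "\<forall>N. ?P N \<longrightarrow> card N < Suc (card (carrier G))"
    using fin by (metis card_mono less_Suc_eq_le normal_imp_subgroup subgroup.subset)
  ultimately have "\<exists>N. ?P N \<and> (\<forall>M. ?P M \<longrightarrow> card M \<le> card N)"
    by (rule Lattices_Big.ex_has_greatest_nat)
  then obtain N where N: "N \<lhd> G" "solvable_seq G N"
    and max: "\<forall>M. M \<lhd> G \<and> solvable_seq G M \<longrightarrow> card M \<le> card N"
    by blast
  interpret N: normal N G by (rule N(1))
  interpret q: group_hom G "G Mod N" "\<lambda>x. N #> x"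
    using N.r_coset_hom_Mod N.factorgroup_is_group group_axioms
    by (simp add: group_hom_axioms_def group_hom_def)
  have ker: "kernel G (G Mod N) (\<lambda>x. N #> x) = N"
    unfolding kernel_def FactGroup_def
    using coset_join1[OF _ _ N.subgroup_axioms] coset_join2[OF _ N.subgroup_axioms] N.subset by auto
  have "N = carrier G"
  proof (rule ccontr)
    assume "N \<noteq> carrier G"
    then obtain y where y: "y \<in> carrier G" "y \<notin> N"
      using N.subset by blast
    have "order (G Mod N) * card N = p ^ n"
      using lagrange[OF N.subgroup_axioms] assms(2) by (simp add: FactGroup_def order_def)
    then obtain k where k: "order (G Mod N) = p ^ k"
      using divides_primepow_nat[OF assms(1)] by (metis dvd_triv_left)
    have "N #> y \<noteq> \<one>\<^bsub>G Mod N\<^esub>"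
      using y ker by (auto simp: kernel_def)
    then have "carrier (G Mod N) \<noteq> {\<one>\<^bsub>G Mod N\<^esub>}"
      using q.hom_closed[OF y(1)] by (metis singletonD)
    then obtain Z where Z: "Z \<in> centralizer (G Mod N) (carrier (G Mod N))" "Z \<noteq> \<one>\<^bsub>G Mod N\<^esub>"
      using q.H.p_group_center_nontrivial[OF assms(1) k] by blast
    have "Z \<in> (\<lambda>x. N #> x) ` carrier G"
      using Z(1) unfolding centralizer_def by (auto simp: FactGroup_def RCOSETS_def)
    then obtain z where z: "z \<in> carrier G" "Z = N #> z"
      by blast
    \<comment> \<open>\<open>M\<close> is the preimage of the center of the quotient;
      \<open>z\<close> witnesses that it exceeds \<open>N\<close>.\<close>
    define M where "M = {x \<in> carrier G. N #> x \<in> centralizer (G Mod N) (carrier (G Mod N))}"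
    have "M \<lhd> G"
      unfolding M_def by (rule q.center_preimage_normal)
    then have subM: "subgroup M G"
      by (rule normal_imp_subgroup)
    have "z \<notin> N"
      using Z(2) z ker unfolding kernel_def by blast
    moreover have "z \<in> M"
      using z Z unfolding M_def by simp
    moreover have "N \<subseteq> M"
    proof
      fix x assume "x \<in> N"
      then have "x \<in> carrier G" "N #> x = \<one>\<^bsub>G Mod N\<^esub>"
        using ker unfolding kernel_def by blast+
      then show "x \<in> M"
        using subgroup.one_closed[OF q.H.centralizer_subgroup[OF subset_refl]]
        unfolding M_def by (metis (mono_tags, lifting) mem_Collect_eq)
    qed
    ultimately have "N \<subset> M"
      by blast
    then have card_lt: "card N < card M"
      using psubset_card_mono finite_subset[OF subgroup.subset[OF subM] fin] by blast
    have "solvable_seq G M"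
    proof (rule solvable_seq_commutators[OF subM N(2)])
      fix x y assume "x \<in> M" "y \<in> M"
      then show "x \<otimes> y \<otimes> inv x \<otimes> inv y \<in> N"
        using q.center_preimage_commutator[of x y] unfolding ker M_def by blast
    qed
    then have "card M \<le> card N"
      using max \<open>M \<lhd> G\<close> by simp
    with card_lt show False
      by simp
  qed
  then show ?thesis
    using N(2) unfolding solvable_def by simp
qed

section \<open>Elements of prime power order\<close>

definition p_elements :: "('a, 'b) monoid_scheme \<Rightarrow> nat \<Rightarrow> 'a set"
  where "p_elements G p = {x \<in> carrier G. \<exists>k::nat. x [^]\<^bsub>G\<^esub> (p ^ k) = \<one>\<^bsub>G\<^esub>}"

lemma (in group) subgroup_pow_card:
  assumes "subgroup H G" "x \<in> H"
  shows "x [^] card H = \<one>"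
proof -
  interpret H: group "G\<lparr>carrier := H\<rparr>"
    by (rule subgroup_imp_group[OF assms(1)])
  show ?thesis
    using H.pow_order_eq_1[of x] assms(2) by (simp add: order_def nat_pow_consistent[symmetric])
qed

text \<open>By Lagrange a Sylow \<open>p\<close>-subgroup consists of elements of
  \<open>p\<close>-power order, so it lies in \<open>H\<close>. Hence \<open>card H\<close> is
  divisible by the full power of every prime in the group order.\<close>

lemma (in group) p_elements_subset_imp_carrier:
  assumes fin: "finite (carrier G)" and H: "subgroup H G"
    and sub: "\<And>p. Factorial_Ring.prime p \<Longrightarrow> p_elements G p \<subseteq> H"
  shows "H = carrier G"
proof -
  have HG: "H \<subseteq> carrier G"
    by (rule subgroup.subset[OF H])
  have pos: "order G \<noteq> 0" "card H \<noteq> 0"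
    using fin order_gt_0_iff_finite subgroup.finite_imp_card_positive[OF H] by auto
  have "order G dvd card H"
  proof (rule multiplicity_le_imp_dvd[OF pos(1)])
    fix p :: nat assume p: "Factorial_Ring.prime p"
    define v where "v = multiplicity p (order G)"
    obtain m where "order G = p ^ v * m"
      using multiplicity_dvd[of p "order G"] unfolding v_def by blast
    then obtain P where P: "subgroup P G" "card P = p ^ v"
      using sylow_thm[OF p group_axioms _ fin] by blast
    have "P \<subseteq> p_elements G p"
      using subgroup_pow_card[OF P(1)] subgroup.subset[OF P(1)] P(2)
      unfolding p_elements_def by auto
    then have "P \<subseteq> H"
      using sub[OF p] by blast
    then have "subgroup P (G\<lparr>carrier := H\<rparr>)"
      using subgroup_incl[OF P(1) H] by blast
    then have "card P dvd card H"
      using group.lagrange[OF subgroup_imp_group[OF H], of P] by (simp add: order_def) (metis dvd_triv_right)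
    then have "p ^ v dvd card H"
      unfolding P(2) .
    moreover have "\<not> is_unit p"
      using not_prime_unit[of p] p by auto
    ultimately show "multiplicity p (order G) \<le> multiplicity p (card H)"
      unfolding v_def by (intro multiplicity_geI pos(2))
  qed
  then have "card (carrier G) \<le> card H"
    using dvd_imp_le pos(2) unfolding order_def by blast
  then show ?thesis
    using card_seteq[OF fin HG] by blast
qed

text \<open>If another prime \<open>q\<close> divided the order, a subgroup of order
  \<open>q\<close> would contain a nontrivial element whose order divides both \<open>q\<close> and
  a power of \<open>p\<close>.\<close>

lemma (in group) p_elements_eq_carrier_imp_prime_power:
  assumes fin: "finite (carrier G)" and p: "Factorial_Ring.prime p"
    and all: "p_elements G p = carrier G"
  shows "\<exists>n. order G = p ^ n"
proof -
  have pos: "order G \<noteq> 0"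
    using fin order_gt_0_iff_finite by simp
  have only_p: "q = p" if q: "Factorial_Ring.prime q" "q dvd order G" for q
  proof (rule ccontr)
    assume "q \<noteq> p"
    \<comment> \<open>Exponent 1 turns Sylow's theorem into Cauchy's.\<close>
    obtain m where "order G = q ^ 1 * m"
      using q(2) by (auto elim: dvdE)
    then obtain H where H: "subgroup H G" "card H = q ^ 1"
      using sylow_thm[OF q(1) group_axioms _ fin] by blast
    have "H \<noteq> {\<one>}"
      using H(2) q(1) by (auto simp: prime_nat_iff)
    then obtain x where x: "x \<in> H" "x \<noteq> \<one>"
      using subgroup.one_closed[OF H(1)] by blast
    then have xG: "x \<in> carrier G"
      using subgroup.subset[OF H(1)] by blast
    then obtain k :: nat where "x [^] (p ^ k) = \<one>"
      using all unfolding p_elements_def by blast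
    then have "ord x dvd p ^ k"
      using pow_eq_id[OF xG] by blast
    moreover have "ord x dvd q"
      using subgroup_pow_card[OF H(1) x(1)] H(2) pow_eq_id[OF xG] by simp
    moreover have "coprime q (p ^ k)"
      using primes_coprime[OF q(1) p \<open>q \<noteq> p\<close>] by simp
    ultimately have "ord x = 1"
      by (metis coprime_def nat_dvd_1_iff_1)
    then show False
      using x(2) xG ord_eq_1 by blast
  qed
  \<comment> \<open>The cofactor \<open>r\<close> is prime to \<open>p\<close>, while any prime
    factor of it would have to be \<open>p\<close>.\<close>
  obtain r where r: "order G = p ^ multiplicity p (order G) * r" "\<not> p dvd r"
    using multiplicity_decompose'[OF pos] p not_prime_unit by blast
  have "r = 1"
  proof (rule ccontr)
    assume "r \<noteq> 1"
    then obtain q where q: "Factorial_Ring.prime q" "q dvd r"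
      using prime_factor_nat by blast
    then have "q dvd order G"
      using r(1) by (metis dvd_mult)
    then show False
      using only_p q r(2) by blast
  qed
  then show ?thesis
    using r(1) by auto
qed

text \<open>\<open>c\<close> is the commutator of \<open>y\<close> and \<open>x\<close>. Moving
  \<open>y\<close> past the \<open>n\<close> factors \<open>x\<close> one at a time produces
  \<open>n\<close> copies of \<open>c\<close>, which are collected because \<open>c\<close> is
  central.\<close>

lemma (in group) central_commutator_pow:
  fixes n :: nat
  assumes x: "x \<in> carrier G" and y: "y \<in> carrier G" and c: "c \<in> centralizer G (carrier G)"
    and yx: "y \<otimes> x = c \<otimes> (x \<otimes> y)"
  shows "y \<otimes> x [^] n = c [^] n \<otimes> (x [^] n \<otimes> y)"
proof (induction n)
  case 0
  then show ?case using x y by simp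
next
  case (Suc n)
  have cG: "c \<in> carrier G" and cx: "\<And>z. z \<in> carrier G \<Longrightarrow> z \<otimes> c = c \<otimes> z"
    using c by (auto simp: centralizer_def)
  have "y \<otimes> x [^] Suc n = (y \<otimes> x [^] n) \<otimes> x"
    using x y by (simp add: m_assoc)
  also have "\<dots> = c [^] n \<otimes> x [^] n \<otimes> (y \<otimes> x)"
    using x y cG Suc.IH by (simp add: m_assoc)
  also have "\<dots> = c [^] n \<otimes> (x [^] n \<otimes> c) \<otimes> (x \<otimes> y)"
    using x y cG yx by (simp add: m_assoc)
  also have "\<dots> = c [^] n \<otimes> (c \<otimes> x [^] n) \<otimes> (x \<otimes> y)"
    using x cx by simp
  also have "\<dots> = c [^] Suc n \<otimes> (x [^] Suc n \<otimes> y)"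
    using x y cG by (simp add: m_assoc)
  finally show ?case .
qed

text \<open>The exponent \<open>e\<close> need not be computed: by the previous lemma the order of \<open>c\<close> divides
  that of \<open>x\<close>, so a further power of \<open>(x \<otimes> y) [^] n\<close> kills the factor \<open>c [^] e\<close>.\<close>

lemma (in group) central_commutator_mult_pow:
  fixes n :: nat
  assumes x: "x \<in> carrier G" and y: "y \<in> carrier G" and c: "c \<in> centralizer G (carrier G)"
    and yx: "y \<otimes> x = c \<otimes> (x \<otimes> y)"
  shows "\<exists>e::nat. (x \<otimes> y) [^] n = c [^] e \<otimes> (x [^] n \<otimes> y [^] n)"
proof (induction n)
  case 0
  then show ?case using c by (auto simp: centralizer_def intro!: exI[of _ 0])
next
  case (Suc n)
  then obtain e :: nat where e: "(x \<otimes> y) [^] n = c [^] e \<otimes> (x [^] n \<otimes> y [^] n)"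
    by blast
  have cG: "c \<in> carrier G"
    using c by (auto simp: centralizer_def)
  have ce: "z \<otimes> c [^] k = c [^] k \<otimes> z" if "z \<in> carrier G" for z and k :: nat
  proof -
    have "subgroup (centralizer G (carrier G)) G"
      by (rule centralizer_subgroup) simp
    then have "c [^] k \<in> centralizer G (carrier G)"
      using c by (induction k) (simp_all add: subgroup.one_closed subgroup.m_closed)
    then show ?thesis
      using that by (simp add: centralizer_def)
  qed
  have "(x \<otimes> y) [^] Suc n = (x \<otimes> y) \<otimes> (x \<otimes> y) [^] n"
    using x y by (simp only: nat_pow_Suc2 m_closed)
  also have "\<dots> = ((x \<otimes> y) \<otimes> c [^] e) \<otimes> (x [^] n \<otimes> y [^] n)"
    using x y cG e by (simp add: m_assoc)
  also have "\<dots> = c [^] e \<otimes> (x \<otimes> (y \<otimes> x [^] n) \<otimes> y [^] n)"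
    using x y cG ce[of "x \<otimes> y" e] by (simp add: m_assoc)
  \<comment> \<open>Passing \<open>y\<close> across \<open>x [^] n\<close> releases
    \<open>c [^] n\<close>, so the exponent grows from \<open>e\<close> to
    \<open>e + n\<close>.\<close>
  also have "\<dots> = c [^] e \<otimes> ((x \<otimes> c [^] n) \<otimes> (x [^] n \<otimes> y) \<otimes> y [^] n)"
    using x y cG central_commutator_pow[OF assms] by (simp add: m_assoc)
  also have "\<dots> = c [^] e \<otimes> c [^] n \<otimes> ((x \<otimes> x [^] n) \<otimes> (y \<otimes> y [^] n))"
    using x y cG ce[of x n] by (simp add: m_assoc)
  also have "\<dots> = c [^] (e + n) \<otimes> (x [^] Suc n \<otimes> y [^] Suc n)"
    using x y cG by (simp only: nat_pow_Suc2 nat_pow_mult)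
  finally show ?case by blast
qed

text \<open>In class at most two a product is controlled by one central commutator \<open>c\<close>:
  a common exponent of \<open>x\<close> and \<open>y\<close> also kills \<open>c\<close>, and
  \<open>x \<otimes> y\<close> raised to it is a power of \<open>c\<close>.\<close>

lemma (in group) p_elements_subgroup:
  assumes central: "derived G (carrier G) \<subseteq> centralizer G (carrier G)"
  shows "subgroup (p_elements G p) G"
proof (rule subgroupI)
  show "p_elements G p \<noteq> {}"
    unfolding p_elements_def by (auto intro!: exI[of _ \<one>])
next
  fix x y assume "x \<in> p_elements G p" "y \<in> p_elements G p"
  then obtain a b :: nat where x: "x \<in> carrier G" "x [^] (p ^ a) = \<one>"
    and y: "y \<in> carrier G" "y [^] (p ^ b) = \<one>"
    unfolding p_elements_def by blast
  \<comment> \<open>A common exponent of \<open>x\<close> and \<open>y\<close> that is again a power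
    of \<open>p\<close>.\<close>
  define m where "m = p ^ (a + b)"
  have xm: "x [^] m = \<one>"
    using x nat_pow_pow[OF x(1), of "p ^ a" "p ^ b"] by (simp add: m_def power_add)
  have ym: "y [^] m = \<one>"
    using y nat_pow_pow[OF y(1), of "p ^ b" "p ^ a"] by (simp add: m_def power_add mult.commute)
  define c where "c = y \<otimes> x \<otimes> inv y \<otimes> inv x"
  have "c \<in> derived G (carrier G)"
    unfolding c_def derived_def using x y by (intro generate.incl) auto
  then have c: "c \<in> centralizer G (carrier G)"
    using central by blast
  have cG: "c \<in> carrier G"
    using c by (simp add: centralizer_def)
  have yx: "y \<otimes> x = c \<otimes> (x \<otimes> y)"
  proof -
    have "c = y \<otimes> x \<otimes> inv (x \<otimes> y)"
      using x(1) y(1) by (simp add: c_def inv_mult_group m_assoc)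
    then show ?thesis
      using x(1) y(1) cG by (simp add: inv_solve_right)
  qed
  \<comment> \<open>With \<open>x [^] m\<close> trivial, the rule for moving \<open>y\<close> past
    \<open>x [^] m\<close> reads \<open>y = c [^] m \<otimes> y\<close>.\<close>
  have cm: "c [^] m = \<one>"
  proof -
    have "c [^] m \<otimes> y = y"
      using central_commutator_pow[OF x(1) y(1) c yx, of m] xm y(1) by simp
    then show ?thesis
      using cG y(1) by (simp add: r_cancel_one)
  qed
  obtain e :: nat where "(x \<otimes> y) [^] m = c [^] e"
    using central_commutator_mult_pow[OF x(1) y(1) c yx, of m] xm ym cG by auto
  \<comment> \<open>The second factor \<open>m\<close> kills the remaining power of
    \<open>c\<close>.\<close>
  then have "(x \<otimes> y) [^] (m * m) = c [^] (e * m)"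
    using x y cG by (metis m_closed nat_pow_pow)
  also have "\<dots> = \<one>"
    using cm cG by (metis mult.commute nat_pow_one nat_pow_pow)
  finally have "(x \<otimes> y) [^] (p ^ (a + b + (a + b))) = \<one>"
    by (simp add: m_def power_add)
  then show "x \<otimes> y \<in> p_elements G p"
    using x y unfolding p_elements_def by blast
qed (auto simp: p_elements_def nat_pow_inv)

section \<open>Characteristic subgroups and automorphisms\<close>

text \<open>Both maps are determined on a generator, which they raise to powers \<open>i\<close> and
  \<open>j\<close>; composing them multiplies the exponents.\<close>

lemma (in group) cyclic_group_endomorphisms_commute:
  assumes "cyclic_group G" "f \<in> hom G G" "g \<in> hom G G" "x \<in> carrier G"
  shows "f (g x) = g (f x)"
proof -
  interpret f: group_hom G G f
    using assms(2) group_axioms by (simp add: group_hom_def group_hom_axioms_def)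
  interpret g: group_hom G G g
    using assms(3) group_axioms by (simp add: group_hom_def group_hom_axioms_def)
  obtain a where a: "a \<in> carrier G" "carrier G = range (\<lambda>n::int. a [^] n)"
    using assms(1) unfolding cyclic_group by blast
  obtain i :: int where i: "f a = a [^] i"
    using f.hom_closed[OF a(1)] a(2) by blast
  obtain j :: int where j: "g a = a [^] j"
    using g.hom_closed[OF a(1)] a(2) by blast
  obtain k :: int where k: "x = a [^] k"
    using assms(4) a(2) by blast
  show ?thesis
    using a(1) by (simp add: i j k f.hom_int_pow g.hom_int_pow int_pow_pow mult.commute mult.left_commute)
qed

lemma (in group) cyclic_subgroup_endomorphisms_commute:
  assumes "subgroup H G" "cyclic_group (G\<lparr>carrier := H\<rparr>)" "f \<in> hom G G" "g \<in> hom G G"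
    and "f ` H \<subseteq> H" "g ` H \<subseteq> H" "x \<in> H"
  shows "f (g x) = g (f x)"
proof -
  have "h \<in> hom (G\<lparr>carrier := H\<rparr>) (G\<lparr>carrier := H\<rparr>)" if "h \<in> hom G G" "h ` H \<subseteq> H" for h
    using that subgroup.subset[OF assms(1)] by (auto simp: hom_def subset_iff)
  with assms show ?thesis
    using group.cyclic_group_endomorphisms_commute[OF subgroup_imp_group[OF assms(1)], of f g x]
    by simp
qed

section \<open>Constructions of characteristic subgroups\<close>

context group
begin

text \<open>Applying the inclusion to the inverse automorphism gives equality.\<close>

lemma characteristic_subgroupI:
  assumes "subgroup H G" and closed: "\<And>f. f \<in> iso G G \<Longrightarrow> f ` H \<subseteq> H"
  shows "characteristic_subgroup H G"
  unfolding characteristic_subgroup_def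
proof (intro conjI ballI subset_antisym subsetI assms(1))
  fix f x assume f: "f \<in> iso G G" and x: "x \<in> H"
  let ?g = "inv_into (carrier G) f"
  have bij: "bij_betw f (carrier G) (carrier G)"
    using f by (simp add: iso_def)
  have "?g \<in> iso G G"
    by (rule iso_set_sym[OF f])
  then have "?g x \<in> H"
    using closed x by blast
  moreover have "f (?g x) = x"
    using bij x subgroup.subset[OF assms(1)] by (auto simp: bij_betw_inv_into_right)
  ultimately show "x \<in> f ` H"
    by (metis imageI)
qed (use closed in blast)

text \<open>Conjugations are automorphisms.\<close>

lemma characteristic_imp_normal:
  assumes "characteristic_subgroup H G"
  shows "H \<lhd> G"
proof (subst normal_inv_iff, intro conjI ballI)
  show H: "subgroup H G"
    using assms by (simp add: characteristic_subgroup_def)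
  fix x h assume x: "x \<in> carrier G" and h: "h \<in> H"
  let ?f = "\<lambda>h\<in>carrier G. x \<otimes> h \<otimes> inv x"
  have "?f \<in> hom G G"
    using x by (auto simp: hom_def m_assoc) (simp add: m_assoc[symmetric])
  then have "?f \<in> iso G G"
    using conjugation_is_bij[OF x] by (simp add: iso_def)
  then have "?f ` H = H"
    using assms unfolding characteristic_subgroup_def by blast
  then have "?f h \<in> H"
    using h by blast
  then show "x \<otimes> h \<otimes> inv x \<in> H"
    using h subgroup.mem_carrier[OF H] by simp
qed

lemma iso_group_hom: "f \<in> iso G G \<Longrightarrow> group_hom G G f"
  using group_axioms by (simp add: group_hom_def group_hom_axioms_def iso_def)

lemma derived_characteristic: "characteristic_subgroup (derived G (carrier G)) G"
proof (rule characteristic_subgroupI)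
  show "subgroup (derived G (carrier G)) G"
    by (rule derived_is_subgroup) simp
  fix f assume f: "f \<in> iso G G"
  then have "f ` carrier G = carrier G"
    by (simp add: iso_def bij_betw_def)
  then show "f ` derived G (carrier G) \<subseteq> derived G (carrier G)"
    using group_hom.derived_img[OF iso_group_hom[OF f], of "carrier G"] by simp
qed

text \<open>Since \<open>f\<close> maps \<open>H\<close> onto itself, each \<open>s\<close> in
  \<open>H\<close> is some \<open>f t\<close> with \<open>t\<close> in \<open>H\<close>, and
  \<open>f\<close> transports the relation between \<open>x\<close> and \<open>t\<close>.\<close>

lemma centralizer_characteristic:
  assumes "characteristic_subgroup H G"
  shows "characteristic_subgroup (centralizer G H) G"
proof (rule characteristic_subgroupI)
  have HG: "H \<subseteq> carrier G"
    using assms by (simp add: characteristic_subgroup_def subgroup.subset)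
  then show "subgroup (centralizer G H) G"
    by (rule centralizer_subgroup)
  fix f assume f: "f \<in> iso G G"
  interpret f: group_hom G G f
    by (rule iso_group_hom[OF f])
  have fH: "f ` H = H"
    using assms f by (simp add: characteristic_subgroup_def)
  show "f ` centralizer G H \<subseteq> centralizer G H"
  proof
    fix y assume "y \<in> f ` centralizer G H"
    then obtain x where x: "x \<in> centralizer G H" "y = f x"
      by blast
    then have xG: "x \<in> carrier G"
      by (simp add: centralizer_def)
    have "f x \<otimes> s = s \<otimes> f x" if "s \<in> H" for s
    proof -
      have "s \<in> f ` H"
        using that fH by simp
      then obtain t where t: "t \<in> H" "s = f t"
        by blast
      then have "x \<otimes> t = t \<otimes> x" "t \<in> carrier G"
        using x HG by (auto simp: centralizer_def)
      then show ?thesis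
        using xG t(2) by (metis f.hom_mult)
    qed
    then show "y \<in> centralizer G H"
      using x xG by (simp add: centralizer_def)
  qed
qed

lemma p_elements_characteristic:
  assumes "derived G (carrier G) \<subseteq> centralizer G (carrier G)"
  shows "characteristic_subgroup (p_elements G p) G"
proof (rule characteristic_subgroupI[OF p_elements_subgroup[OF assms]])
  fix f assume "f \<in> iso G G"
  then interpret f: group_hom G G f
    by (rule iso_group_hom)
  show "f ` p_elements G p \<subseteq> p_elements G p"
    by (auto simp: p_elements_def f.hom_nat_pow[symmetric]) (metis f.hom_one)
qed

section \<open>The automorphism group and its commutators\<close>

lemma AutoGroup_carrier: "carrier (AutoGroup G) = auto G"
  by (simp add: AutoGroup_def)

lemma AutoGroup_mult_apply:
  assumes "f \<in> auto G" "g \<in> auto G" "x \<in> carrier G"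
  shows "(f \<otimes>\<^bsub>AutoGroup G\<^esub> g) x = f (g x)"
  using assms by (simp add: AutoGroup_def BijGroup_def auto_def compose_def)

lemma AutoGroup_one_apply: "x \<in> carrier G \<Longrightarrow> \<one>\<^bsub>AutoGroup G\<^esub> x = x"
  by (simp add: AutoGroup_def BijGroup_def)

lemma auto_imp_iso: "f \<in> auto G \<Longrightarrow> f \<in> iso G G"
  by (simp add: auto_def iso_def Bij_def)

text \<open>Members of \<open>auto G\<close> are extensional: outside the carrier all of them take
  the same value.\<close>

lemma auto_eqI:
  assumes "f \<in> auto G" "g \<in> auto G" "\<And>x. x \<in> carrier G \<Longrightarrow> f x = g x"
  shows "f = g"
  using assms by (auto simp: auto_def Bij_def intro: extensionalityI)

text \<open>The commutator sends \<open>g (f y)\<close> to \<open>f (g y)\<close>, and these agree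
  for \<open>y\<close> in \<open>C\<close>; every \<open>x\<close> in \<open>C\<close> has the form
  \<open>g (f y)\<close> because \<open>f\<close> and \<open>g\<close> permute
  \<open>C\<close>.\<close>

lemma auto_commutator_fixes:
  assumes C: "characteristic_subgroup C G" and f: "f \<in> auto G" and g: "g \<in> auto G"
    and comm: "\<And>y. y \<in> C \<Longrightarrow> f (g y) = g (f y)" and x: "x \<in> C"
  shows "(f \<otimes>\<^bsub>AutoGroup G\<^esub> g \<otimes>\<^bsub>AutoGroup G\<^esub> inv\<^bsub>AutoGroup G\<^esub> f \<otimes>\<^bsub>AutoGroup G\<^esub> inv\<^bsub>AutoGroup G\<^esub> g) x = x"
proof -
  interpret A: group "AutoGroup G"
    by (rule AutoGroup)
  note carr = AutoGroup_carrier[symmetric]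
  let ?c = "f \<otimes>\<^bsub>AutoGroup G\<^esub> g \<otimes>\<^bsub>AutoGroup G\<^esub> inv\<^bsub>AutoGroup G\<^esub> f \<otimes>\<^bsub>AutoGroup G\<^esub> inv\<^bsub>AutoGroup G\<^esub> g"
  have fA: "f \<in> carrier (AutoGroup G)" and gA: "g \<in> carrier (AutoGroup G)"
    using f g by (simp_all add: AutoGroup_carrier)
  have CG: "C \<subseteq> carrier G"
    using C by (simp add: characteristic_subgroup_def subgroup.subset)
  have "h ` C = C" if "h \<in> auto G" for h
    using C auto_imp_iso[OF that] by (simp add: characteristic_subgroup_def)
  then have "x \<in> g ` f ` C"
    using x f g by simp
  then obtain y where y: "y \<in> C" "x = g (f y)"
    by blast
  then have yG: "y \<in> carrier G"
    using CG by blast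
  have "?c = f \<otimes>\<^bsub>AutoGroup G\<^esub> g \<otimes>\<^bsub>AutoGroup G\<^esub> inv\<^bsub>AutoGroup G\<^esub> (g \<otimes>\<^bsub>AutoGroup G\<^esub> f)"
    using fA gA by (simp add: A.inv_mult_group A.m_assoc)
  then have "?c \<otimes>\<^bsub>AutoGroup G\<^esub> (g \<otimes>\<^bsub>AutoGroup G\<^esub> f) = f \<otimes>\<^bsub>AutoGroup G\<^esub> g"
    using fA gA by (simp add: A.m_assoc)
  moreover have "(?c \<otimes>\<^bsub>AutoGroup G\<^esub> (g \<otimes>\<^bsub>AutoGroup G\<^esub> f)) y = ?c x"
  proof -
    have "?c \<in> auto G" "g \<otimes>\<^bsub>AutoGroup G\<^esub> f \<in> auto G"
      using fA gA unfolding carr by simp_all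
    then show ?thesis
      using AutoGroup_mult_apply f g y(2) yG by simp
  qed
  ultimately have "?c x = f (g y)"
    using AutoGroup_mult_apply[OF f g yG] by simp
  then show ?thesis
    using comm[OF y(1)] y(2) by simp
qed

section \<open>Criteria for a solvable automorphism group\<close>

lemma AutoGroup_solvable_of_commuting:
  assumes comm: "\<And>f g x. \<lbrakk>f \<in> auto G; g \<in> auto G; x \<in> carrier G\<rbrakk> \<Longrightarrow> f (g x) = g (f x)"
  shows "solvable (AutoGroup G)"
proof -
  interpret A: group "AutoGroup G"
    by (rule AutoGroup)
  show ?thesis
    unfolding solvable_def
  proof (rule A.solvable_seq_commutators[OF A.subgroup_self solvable_seq.unity])
    fix f g assume fg: "f \<in> carrier (AutoGroup G)" "g \<in> carrier (AutoGroup G)"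
    then have "f \<otimes>\<^bsub>AutoGroup G\<^esub> g = g \<otimes>\<^bsub>AutoGroup G\<^esub> f"
      using comm A.m_closed by (intro auto_eqI) (auto simp: AutoGroup_carrier AutoGroup_mult_apply)
    then show "f \<otimes>\<^bsub>AutoGroup G\<^esub> g \<otimes>\<^bsub>AutoGroup G\<^esub> inv\<^bsub>AutoGroup G\<^esub> f \<otimes>\<^bsub>AutoGroup G\<^esub> inv\<^bsub>AutoGroup G\<^esub> g
        \<in> {\<one>\<^bsub>AutoGroup G\<^esub>}"
      using fg A.commutator_eq_one_iff by blast
  qed
qed

text \<open>Automorphisms that fix \<open>C\<close> pointwise move every element by a factor that centralizes \<open>C\<close>,
  so they commute with each other; and the automorphisms of the cyclic group \<open>C\<close> commute.\<close>

lemma AutoGroup_solvable_of_self_centralizing_cyclic: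
  assumes C: "characteristic_subgroup C G" and cyc: "cyclic_group (G\<lparr>carrier := C\<rparr>)"
    and self: "centralizer G C \<subseteq> C"
  shows "solvable (AutoGroup G)"
proof -
  interpret A: group "AutoGroup G"
    by (rule AutoGroup)
  have subC: "subgroup C G"
    using C by (simp add: characteristic_subgroup_def)
  interpret C: normal C G
    by (rule characteristic_imp_normal[OF C])
  interpret CC: comm_group "G\<lparr>carrier := C\<rparr>"
    by (rule group.cyclic_imp_abelian_group[OF subgroup_imp_group[OF subC] cyc])
  \<comment> \<open>\<open>F\<close> is the kernel of the restriction of automorphisms to
    \<open>C\<close>. The commutator criterion is used twice: from the trivial subgroup to
    \<open>F\<close>, and from \<open>F\<close> to all automorphisms.\<close>
  define F where "F = {f \<in> auto G. \<forall>x\<in>C. f x = x}"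
  have homG: "f \<in> hom G G" if "f \<in> auto G" for f
    using that by (simp add: auto_def)
  have closedG: "f x \<in> carrier G" if "f \<in> auto G" "x \<in> carrier G" for f x
    using homG that by (auto simp: hom_def)
  have CG: "x \<in> carrier G" if "x \<in> C" for x
    using that C.subset by blast
  have factor: "f x \<otimes> inv x \<in> C" if f: "f \<in> F" and x: "x \<in> carrier G" for f x
  proof -
    have fa: "f \<in> auto G" and fC: "\<And>y. y \<in> C \<Longrightarrow> f y = y"
      using f by (auto simp: F_def)
    interpret f: group_hom G G f
      by (rule iso_group_hom[OF auto_imp_iso[OF fa]])
    have fx: "f x \<in> carrier G"
      using x by simp
    have "f x \<otimes> inv x \<otimes> y = y \<otimes> (f x \<otimes> inv x)" if y: "y \<in> C" for y
    proof -
      have yG: "y \<in> carrier G"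
        using CG y by blast
      \<comment> \<open>\<open>?z\<close> lies in \<open>C\<close> by normality and is therefore
        fixed by \<open>f\<close>; applying \<open>f\<close> to
        \<open>x \<otimes> ?z = y \<otimes> x\<close> shows that \<open>f x \<otimes> inv x\<close>
        commutes with \<open>y\<close>.\<close>
      let ?z = "inv x \<otimes> y \<otimes> x"
      have zC: "?z \<in> C"
        using C.inv_op_closed1[OF x y] .
      then have zG: "?z \<in> carrier G" and fz: "f ?z = ?z"
        using CG fC by blast+
      have "f x \<otimes> ?z = f (x \<otimes> ?z)"
        using x zG fz by (simp only: f.hom_mult)
      also have "x \<otimes> ?z = y \<otimes> x"
        using x yG by (simp add: m_assoc[symmetric])
      also have "f (y \<otimes> x) = y \<otimes> f x"
        using x yG fC[OF y] by simp
      finally have "f x \<otimes> ?z \<otimes> inv x = y \<otimes> f x \<otimes> inv x"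
        by simp
      then show ?thesis
        using x yG fx by (simp add: m_assoc)
    qed
    then show ?thesis
      using self fx x by (auto simp: centralizer_def)
  qed
  have subF: "subgroup F (AutoGroup G)"
  proof (rule A.subgroupI)
    show "F \<subseteq> carrier (AutoGroup G)"
      by (auto simp: F_def AutoGroup_carrier)
    have "\<one>\<^bsub>AutoGroup G\<^esub> \<in> F"
      using A.one_closed CG AutoGroup_one_apply by (auto simp: F_def AutoGroup_carrier)
    then show "F \<noteq> {}"
      by blast
  next
    fix f assume f: "f \<in> F"
    then have fA: "f \<in> carrier (AutoGroup G)"
      by (simp add: F_def AutoGroup_carrier)
    let ?g = "inv\<^bsub>AutoGroup G\<^esub> f"
    have gA: "?g \<in> auto G"
      using A.inv_closed[OF fA] by (simp add: AutoGroup_carrier)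
    have "?g x = x" if "x \<in> C" for x
    proof -
      have "?g x = ?g (f x)"
        using f that by (simp add: F_def)
      also have "\<dots> = (?g \<otimes>\<^bsub>AutoGroup G\<^esub> f) x"
        by (rule AutoGroup_mult_apply[OF gA, symmetric]) (use f CG that in \<open>auto simp: F_def\<close>)
      also have "\<dots> = x"
        using fA CG[OF that] by (simp add: AutoGroup_one_apply)
      finally show ?thesis .
    qed
    then show "?g \<in> F"
      using gA by (simp add: F_def)
  next
    fix f g assume "f \<in> F" "g \<in> F"
    then show "f \<otimes>\<^bsub>AutoGroup G\<^esub> g \<in> F"
      using A.m_closed[of f g] CG by (auto simp: F_def AutoGroup_carrier AutoGroup_mult_apply)
  qed
  have "solvable_seq (AutoGroup G) F"
  proof (rule A.solvable_seq_commutators[OF subF solvable_seq.unity])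
    fix f g assume f: "f \<in> F" and g: "g \<in> F"
    then have fa: "f \<in> auto G" and ga: "g \<in> auto G"
      by (simp_all add: F_def)
    then have fgA: "f \<in> carrier (AutoGroup G)" "g \<in> carrier (AutoGroup G)"
      by (simp_all add: AutoGroup_carrier)
    \<comment> \<open>The factor by which \<open>k\<close> moves \<open>x\<close> lies in
      \<open>C\<close>, so \<open>h\<close> fixes it. Swapping \<open>h\<close> and \<open>k\<close>
      then only interchanges two elements of the abelian \<open>C\<close>.\<close>
    have expand: "h (k x) = (k x \<otimes> inv x) \<otimes> (h x \<otimes> inv x) \<otimes> x"
      if h: "h \<in> F" and k: "k \<in> F" and x: "x \<in> carrier G" for h k x
    proof -
      have ha: "h \<in> auto G" and ka: "k \<in> auto G"
        using h k by (simp_all add: F_def)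
      interpret h: group_hom G G h
        by (rule iso_group_hom[OF auto_imp_iso[OF ha]])
      have kx: "k x \<in> carrier G" and hx: "h x \<in> carrier G"
        using closedG ha ka x by blast+
      have "h (k x) = h ((k x \<otimes> inv x) \<otimes> x)"
        using kx x by (simp add: m_assoc)
      also have "\<dots> = h (k x \<otimes> inv x) \<otimes> h x"
        using kx x by (intro h.hom_mult) simp_all
      also have "h (k x \<otimes> inv x) = k x \<otimes> inv x"
        using factor[OF k x] h by (simp add: F_def)
      finally show ?thesis
        using kx hx x by (simp add: m_assoc)
    qed
    have "f (g x) = g (f x)" if x: "x \<in> carrier G" for x
      unfolding expand[OF f g x] expand[OF g f x]
      using CC.m_comm[of "g x \<otimes> inv x" "f x \<otimes> inv x"] factor[OF f x] factor[OF g x] by simp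
    then have "f \<otimes>\<^bsub>AutoGroup G\<^esub> g = g \<otimes>\<^bsub>AutoGroup G\<^esub> f"
      using fa ga A.m_closed[of f g] A.m_closed[of g f]
      by (intro auto_eqI) (auto simp: AutoGroup_carrier AutoGroup_mult_apply)
    then show "f \<otimes>\<^bsub>AutoGroup G\<^esub> g \<otimes>\<^bsub>AutoGroup G\<^esub> inv\<^bsub>AutoGroup G\<^esub> f \<otimes>\<^bsub>AutoGroup G\<^esub> inv\<^bsub>AutoGroup G\<^esub> g
        \<in> {\<one>\<^bsub>AutoGroup G\<^esub>}"
      using fgA A.commutator_eq_one_iff by blast
  qed
  then show ?thesis
    unfolding solvable_def
  proof (rule A.solvable_seq_commutators[OF A.subgroup_self])
    fix f g assume fg: "f \<in> carrier (AutoGroup G)" "g \<in> carrier (AutoGroup G)"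
    then have fga: "f \<in> auto G" "g \<in> auto G"
      by (simp_all add: AutoGroup_carrier)
    have "h ` C \<subseteq> C" if "h \<in> auto G" for h
      using C auto_imp_iso[OF that] by (simp add: characteristic_subgroup_def)
    with fga have "f ` C \<subseteq> C" "g ` C \<subseteq> C"
      by blast+
    \<comment> \<open>Automorphisms commute on the cyclic \<open>C\<close>, so their commutators fix
      it pointwise and lie in \<open>F\<close>.\<close>
    then have "f (g x) = g (f x)" if "x \<in> C" for x
      by (intro cyclic_subgroup_endomorphisms_commute[OF subC cyc _ _ _ _ that] homG fga)
    then have "(f \<otimes>\<^bsub>AutoGroup G\<^esub> g \<otimes>\<^bsub>AutoGroup G\<^esub> inv\<^bsub>AutoGroup G\<^esub> f \<otimes>\<^bsub>AutoGroup G\<^esub> inv\<^bsub>AutoGroup G\<^esub> g) x = x"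
      if "x \<in> C" for x
      using auto_commutator_fixes[OF C fga _ that] by blast
    then show "f \<otimes>\<^bsub>AutoGroup G\<^esub> g \<otimes>\<^bsub>AutoGroup G\<^esub> inv\<^bsub>AutoGroup G\<^esub> f \<otimes>\<^bsub>AutoGroup G\<^esub> inv\<^bsub>AutoGroup G\<^esub> g \<in> F"
      using fg by (simp add: F_def AutoGroup_carrier[symmetric])
  qed
qed

text \<open>The alternative is kept because a prime power order settles the brace by itself; in that
  case nothing is claimed about the automorphism group.\<close>

theorem CCS_order_prime_power_or_AutoGroup_solvable:
  assumes "CCS_group G" "solvable G"
  shows "(\<exists>p n. Factorial_Ring.prime p \<and> order G = p ^ n) \<or> solvable (AutoGroup G)"
proof -
  have fin: "finite (carrier G)" and ncyc: "\<not> cyclic_group G"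
    and cyc: "\<And>H. \<lbrakk>characteristic_subgroup H G; H \<noteq> carrier G\<rbrakk> \<Longrightarrow> cyclic_group (G\<lparr>carrier := H\<rparr>)"
    using assms(1) by (auto simp: CCS_group_def)
  define D where "D = derived G (carrier G)"
  define C where "C = centralizer G D"
  have D: "characteristic_subgroup D G"
    unfolding D_def by (rule derived_characteristic)
  then have C: "characteristic_subgroup C G"
    unfolding C_def by (rule centralizer_characteristic)
  have subD: "subgroup D G"
    using D by (simp add: characteristic_subgroup_def)
  \<comment> \<open>A solvable group equal to its derived subgroup is trivial, hence cyclic.\<close>
  have "D \<noteq> carrier G"
  proof
    assume eq: "D = carrier G"
    obtain n where "(derived G ^^ n) (carrier G) = {\<one>}"
      using assms(2) solvable_iff_trivial_derived_seq by blast
    moreover have "(derived G ^^ n) (carrier G) = carrier G"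
      using eq by (induction n) (simp_all add: D_def)
    ultimately have "trivial_group G"
      using group_axioms by (simp add: trivial_group_def)
    then show False
      using ncyc trivial_imp_cyclic_group by blast
  qed
  then have cycD: "cyclic_group (G\<lparr>carrier := D\<rparr>)"
    by (rule cyc[OF D])
  interpret DD: comm_group "G\<lparr>carrier := D\<rparr>"
    by (rule group.cyclic_imp_abelian_group[OF subgroup_imp_group[OF subD] cycD])
  \<comment> \<open>\<open>D\<close> is abelian and so centralizes itself.\<close>
  have DC: "D \<subseteq> C"
    using DD.m_comm subgroup.subset[OF subD] by (auto simp: C_def centralizer_def)
  show ?thesis
  proof (cases "C = carrier G")
    case False
    \<comment> \<open>Whatever centralizes \<open>C\<close> centralizes \<open>D\<close>, because
      \<open>D\<close> lies in \<open>C\<close>.\<close>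
    have "centralizer G C \<subseteq> C"
      using DC by (auto simp: C_def centralizer_def)
    then show ?thesis
      using AutoGroup_solvable_of_self_centralizing_cyclic[OF C cyc[OF C False]] by blast
  next
    case True
    \<comment> \<open>Here \<open>C\<close> is the whole group, which says that \<open>D\<close> is
      central.\<close>
    have central: "derived G (carrier G) \<subseteq> centralizer G (carrier G)"
    proof
      fix d assume d: "d \<in> derived G (carrier G)"
      have "d \<otimes> x = x \<otimes> d" if "x \<in> carrier G" for x
      proof -
        have "x \<in> centralizer G D"
          using that True by (simp add: C_def)
        then show ?thesis
          using d by (simp add: centralizer_def D_def)
      qed
      then show "d \<in> centralizer G (carrier G)"
        using d subgroup.mem_carrier[OF subD] by (simp add: centralizer_def D_def)
    qed
    note P = p_elements_characteristic[OF central]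
    show ?thesis
    proof (cases "\<exists>p. Factorial_Ring.prime p \<and> p_elements G p = carrier G")
      case True
      then show ?thesis
        using p_elements_eq_carrier_imp_prime_power[OF fin] by blast
    next
      case False
      have "f (g x) = g (f x)" if f: "f \<in> auto G" and g: "g \<in> auto G" and x: "x \<in> carrier G" for f g x
      proof -
        interpret f: group_hom G G f
          by (rule iso_group_hom[OF auto_imp_iso[OF f]])
        interpret g: group_hom G G g
          by (rule iso_group_hom[OF auto_imp_iso[OF g]])
        \<comment> \<open>The elements on which \<open>f\<close> and \<open>g\<close> commute form a
          subgroup; it contains all elements of prime power order, so it is everything.\<close>
        let ?H = "{x \<in> carrier G. f (g x) = g (f x)}"
        have "subgroup ?H G"
          by (rule subgroupI) (auto intro!: exI[of _ \<one>])
        moreover have "p_elements G p \<subseteq> ?H" if "Factorial_Ring.prime p" for p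
        proof
          fix y assume y: "y \<in> p_elements G p"
          have sub: "subgroup (p_elements G p) G"
            using P by (simp add: characteristic_subgroup_def)
          have "h ` p_elements G p \<subseteq> p_elements G p" if "h \<in> auto G" for h
            using P auto_imp_iso[OF that] by (simp add: characteristic_subgroup_def)
          moreover have "cyclic_group (G\<lparr>carrier := p_elements G p\<rparr>)"
            using cyc[OF P] False that by blast
          ultimately have "f (g y) = g (f y)"
            using cyclic_subgroup_endomorphisms_commute[OF sub _ f.homh g.homh] f g y by blast
          then show "y \<in> ?H"
            using y subgroup.mem_carrier[OF sub] by blast
        qed
        ultimately have "?H = carrier G"
          by (rule p_elements_subset_imp_carrier[OF fin])
        then show ?thesis
          using x by blast
      qed
      then show ?thesis
        using AutoGroup_solvable_of_commuting by blast
    qed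
  qed
qed

end

section \<open>Skew braces\<close>

context skew_brace
begin

sublocale mult: group B
  by (rule mult_group)

sublocale add: group "add_monoid B"
  rewrites "carrier (add_monoid B) = carrier B"
    and "monoid.mult (add_monoid B) = ring.add B"
    and "monoid.one (add_monoid B) = ring.zero B"
    and "m_inv (add_monoid B) = a_inv B"
  by (rule add_group) (auto simp: a_inv_def)

text \<open>The usual action of the multiplicative group on the additive one. Restricting it to the
  carrier makes it extensional, as membership in \<open>auto\<close> demands.\<close>

definition lambda_map :: "'a \<Rightarrow> 'a \<Rightarrow> 'a"
  where "lambda_map a = (\<lambda>b\<in>carrier B. \<ominus> a \<oplus> a \<otimes> b)"

lemma lambda_map_closed [simp]:
  "\<lbrakk>a \<in> carrier B; b \<in> carrier B\<rbrakk> \<Longrightarrow> lambda_map a b \<in> carrier B"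
  by (simp add: lambda_map_def)

lemma mult_eq_add_lambda_map:
  "\<lbrakk>a \<in> carrier B; b \<in> carrier B\<rbrakk> \<Longrightarrow> a \<otimes> b = a \<oplus> lambda_map a b"
  by (simp add: lambda_map_def add.m_assoc[symmetric])

text \<open>Adding \<open>\<ominus> a\<close> on the left of the skew distributive law splits its
  right side into the two values.\<close>

lemma lambda_map_add:
  assumes "a \<in> carrier B" "b \<in> carrier B" "c \<in> carrier B"
  shows "lambda_map a (b \<oplus> c) = lambda_map a b \<oplus> lambda_map a c"
  using assms by (simp add: lambda_map_def skew_distrib a_minus_def add.m_assoc)

lemma lambda_map_zero:
  assumes "a \<in> carrier B"
  shows "lambda_map a \<zero> = \<zero>"
  using lambda_map_add[OF assms add.one_closed add.one_closed] assms by simp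

text \<open>Both are the value of \<open>\<one> \<otimes> \<zero>\<close>, since
  \<open>lambda_map \<one>\<close> fixes \<open>\<zero>\<close>.\<close>

lemma zero_eq_one: "\<zero> = \<one>"
  using mult_eq_add_lambda_map[of \<one> \<zero>] lambda_map_zero[of \<one>] by simp

text \<open>Write each product \<open>x \<otimes> y\<close> as
  \<open>x \<oplus> lambda_map x y\<close> in both bracketings of
  \<open>a \<otimes> b \<otimes> c\<close>, then cancel \<open>a \<otimes> b\<close>.\<close>

lemma lambda_map_mult:
  assumes a: "a \<in> carrier B" and b: "b \<in> carrier B" and c: "c \<in> carrier B"
  shows "lambda_map (a \<otimes> b) c = lambda_map a (lambda_map b c)"
proof -
  have "a \<otimes> b \<oplus> lambda_map (a \<otimes> b) c = a \<otimes> b \<otimes> c"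
    using assms by (simp add: mult_eq_add_lambda_map[of "a \<otimes> b"])
  also have "\<dots> = a \<otimes> (b \<oplus> lambda_map b c)"
    using assms by (simp add: mult.m_assoc mult_eq_add_lambda_map[of b])
  also have "\<dots> = a \<oplus> (lambda_map a b \<oplus> lambda_map a (lambda_map b c))"
    using assms by (simp add: mult_eq_add_lambda_map[of a] lambda_map_add)
  also have "\<dots> = a \<otimes> b \<oplus> lambda_map a (lambda_map b c)"
    using assms by (simp add: mult_eq_add_lambda_map[of a] add.m_assoc)
  finally show ?thesis
    using assms by simp
qed

lemma lambda_map_one: "b \<in> carrier B \<Longrightarrow> lambda_map \<one> b = b"
  using mult_eq_add_lambda_map[of \<one> b] add.l_one[of "lambda_map \<one> b"] by (simp add: zero_eq_one)

text \<open>The inverse map is \<open>lambda_map (inv a)\<close>.\<close>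

lemma lambda_map_auto:
  assumes a: "a \<in> carrier B"
  shows "lambda_map a \<in> auto (add_monoid B)"
proof -
  have inverse: "lambda_map x (lambda_map y b) = b"
    if "x \<in> carrier B" "y \<in> carrier B" "x \<otimes> y = \<one>" "b \<in> carrier B" for x y b
    using that lambda_map_mult[of x y b] lambda_map_one by simp
  have "bij_betw (lambda_map a) (carrier B) (carrier B)"
    using a inverse[of a "inv a"] inverse[of "inv a" a]
    by (intro bij_betwI[where g = "lambda_map (inv a)"]) auto
  then show ?thesis
    using a by (auto simp: auto_def Bij_def hom_def lambda_map_add) (simp add: lambda_map_def)
qed

lemma lambda_map_group_hom: "group_hom B (AutoGroup (add_monoid B)) lambda_map"
proof (intro group_hom.intro group_hom_axioms.intro homI mult_group)
  show "group (AutoGroup (add_monoid B))"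
    by (rule group.AutoGroup[OF add_group])
  fix a b assume a: "a \<in> carrier B" and b: "b \<in> carrier B"
  show "lambda_map a \<in> carrier (AutoGroup (add_monoid B))"
    using lambda_map_auto[OF a] by (simp add: group.AutoGroup_carrier[OF add_group])
  interpret Aut: group "AutoGroup (add_monoid B)"
    by (rule group.AutoGroup[OF add_group])
  show "lambda_map (a \<otimes> b) = lambda_map a \<otimes>\<^bsub>AutoGroup (add_monoid B)\<^esub> lambda_map b"
  proof (rule group.auto_eqI[OF add_group])
    show "lambda_map (a \<otimes> b) \<in> auto (add_monoid B)"
      using a b by (intro lambda_map_auto) simp
    show "lambda_map a \<otimes>\<^bsub>AutoGroup (add_monoid B)\<^esub> lambda_map b \<in> auto (add_monoid B)"
      using Aut.m_closed lambda_map_auto a b by (simp add: group.AutoGroup_carrier[OF add_group])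
    fix x assume "x \<in> carrier (add_monoid B)"
    then show "lambda_map (a \<otimes> b) x = (lambda_map a \<otimes>\<^bsub>AutoGroup (add_monoid B)\<^esub> lambda_map b) x"
      using group.AutoGroup_mult_apply[OF add_group lambda_map_auto[OF a] lambda_map_auto[OF b]] a b
      by (simp add: lambda_map_mult)
  qed
qed

text \<open>The image of \<open>lambda_map\<close> lies in the solvable automorphism group, and its
  kernel embeds into the solvable additive group by the identity.\<close>

theorem solvable_of_AutoGroup_solvable:
  assumes add: "solvable (add_monoid B)" and Aut: "solvable (AutoGroup (add_monoid B))"
  shows "solvable B"
proof -
  interpret lam: group_hom B "AutoGroup (add_monoid B)" lambda_map
    by (rule lambda_map_group_hom)
  let ?K = "kernel B (AutoGroup (add_monoid B)) lambda_map"
  have K: "subgroup ?K B"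
    by (rule lam.subgroup_kernel)
  have Kgroup: "group (B\<lparr>carrier := ?K\<rparr>)"
    by (rule mult.subgroup_imp_group[OF K])
  have mult_eq_add: "a \<otimes> b = a \<oplus> b" if "a \<in> ?K" "b \<in> carrier B" for a b
  proof -
    have "lambda_map a b = b"
      using that group.AutoGroup_one_apply[OF add_group, of b] by (simp add: kernel_def)
    then show ?thesis
      using that mult_eq_add_lambda_map[of a b] by (simp add: kernel_def)
  qed
  have "group_hom (B\<lparr>carrier := ?K\<rparr>) (add_monoid B) id"
    using Kgroup add_group mult_eq_add subgroup.subset[OF K]
    by (auto simp: group_hom_def group_hom_axioms_def hom_def subset_iff)
  then have "solvable (B\<lparr>carrier := ?K\<rparr>)"
    using group_hom.inj_hom_imp_solvable add by (metis inj_on_id)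
  moreover have "group_hom (B\<lparr>carrier := ?K\<rparr>) B id"
    using Kgroup mult_group subgroup.subset[OF K]
    by (auto simp: group_hom_def group_hom_axioms_def hom_def subset_iff)
  moreover have "solvable_seq (AutoGroup (add_monoid B)) (lambda_map ` carrier B)"
    using lam.H.solvable_subgroup[OF lam.img_is_subgroup Aut] .
  ultimately have "solvable_seq B (carrier B)"
    \<comment> \<open>The kernel enters \<open>B\<close> by the inclusion \<open>id\<close>, and
      \<open>lambda_map\<close> leads out of \<open>B\<close>; solvability at both ends passes to
      the middle.\<close>
    using solvable_seq_condition[of "B\<lparr>carrier := ?K\<rparr>" B id "AutoGroup (add_monoid B)" lambda_map ?K "carrier B"]
      lambda_map_group_hom mult.subgroup_self subgroup.subset[OF K]
    by (simp add: solvable_def)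
  then show ?thesis
    by (simp add: solvable_def)
qed

end

theorem corollary1p4:
  fixes B :: "('a, 'b) ring_scheme"
  assumes "skew_brace B"
    and "finite (carrier B)"
    and "solvable (add_monoid B)"
    and "CCS_group (add_monoid B)"
  shows "solvable B"
proof -
  interpret skew_brace B
    by (rule assms(1))
  consider p n where "Factorial_Ring.prime p" "order (add_monoid B) = p ^ n"
    | "solvable (AutoGroup (add_monoid B))"
    using group.CCS_order_prime_power_or_AutoGroup_solvable[OF add_group assms(4,3)] by blast
  then show ?thesis
  proof cases
    case 1
    \<comment> \<open>Both groups have the same carrier, so the multiplicative group has order
      \<open>p ^ n\<close> as well.\<close>
    then show ?thesis
      using mult.p_group_solvable by (simp add: order_def)
  next
    case 2
    then show ?thesis
      by (rule solvable_of_AutoGroup_solvable[OF assms(3)])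
  qed
qed

end
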